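(* Each type composition $\widehat{n}=(n_1,\dots,n_t)\in\mathbb{N}_{>0}^t$ with $t\ge 6$ is non-weighted.
   Context: A simple game is a pair $(v,N)$ with $N$ a finite set (of agents) and $v:2^N\to\{0,1\}$ satisfying $v(\emptyset)=0$, $v(N)=1$, and $v(S)\le v(T)$ for all $S\subseteq T\subseteq N$. For agents $i,j$ write $i\sqsupset j$ if $v(\{i\}\cup S\setminus\{j\})\ge v(S)$ for all $\{j\}\subseteq S\subseteq N\setminus\{i\}$, and $i\,\square\, j$ if both $i\sqsupset j$ and $j\sqsupset i$. A simple game is complete if $\sqsupset$ is a total preorder (reflexive, total, transitive). The relation $\square$ partitions $N$ into equivalence classes $N_1,\dots,N_t$, numbered in order of decreasing desirability (agents in $N_1$ are the most desirable with respect to $\sqsupset$); $t$ is the number of types and $(n_1,\dots,n_t)\in\mathbb{N}_{>0}^t$ with $n_i=|N_i|$ is the type composition of the game. A simple game $(v,N)$ is weighted if there exist weights $w_i\in\mathbb{R}_{\ge 0}$ for $i\in N$ and a quota $q\in\mathbb{R}_{>0}$ such that, for all $S\subseteq N$, $v(S)=1$ if and only if $\sum_{i\in S}w_i\ge q$. A type composition $\widehat{n}\in\mathbb{N}_{>0}^t$ is called weighted if all complete simple games with type composition $\widehat{n}$ are weighted; otherwise (i.e. if some complete simple game with type composition $\widehat{n}$ is not weighted) it is called non-weighted. *)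

theory Defs
  imports Complex_Main
begin

(* A game is given by its value function v and its agent set N; v is a function on all sets of
   agents, but only its values on subsets of N are ever constrained or used. *)

definition simple_game :: "('a set \<Rightarrow> nat) \<Rightarrow> 'a set \<Rightarrow> bool" where
  "simple_game v N \<longleftrightarrow>
     finite N \<and> (\<forall>S. S \<subseteq> N \<longrightarrow> v S \<in> {0, 1}) \<and> v {} = 0 \<and> v N = 1 \<and>
     (\<forall>S T. S \<subseteq> T \<and> T \<subseteq> N \<longrightarrow> v S \<le> v T)"

(* (i, j) \<in> desirability v N means that i is at least as desirable as j. For i = j the condition
   is vacuous. *)

definition desirability :: "('a set \<Rightarrow> nat) \<Rightarrow> 'a set \<Rightarrow> ('a \<times> 'a) set" where
  "desirability v N =
     {(i, j). i \<in> N \<and> j \<in> N \<and>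
        (\<forall>S. {j} \<subseteq> S \<and> S \<subseteq> N - {i} \<longrightarrow> v (({i} \<union> S) - {j}) \<ge> v S)}"

definition equi_desirability :: "('a set \<Rightarrow> nat) \<Rightarrow> 'a set \<Rightarrow> ('a \<times> 'a) set" where
  "equi_desirability v N = {(i, j). (i, j) \<in> desirability v N \<and> (j, i) \<in> desirability v N}"

definition complete_simple_game :: "('a set \<Rightarrow> nat) \<Rightarrow> 'a set \<Rightarrow> bool" where
  "complete_simple_game v N \<longleftrightarrow>
     simple_game v N \<and> preorder_on N (desirability v N) \<and> total_on N (desirability v N)"

(* Ps lists each equivalence class exactly once, in order of strictly decreasing desirability. *)

definition type_classes :: "('a set \<Rightarrow> nat) \<Rightarrow> 'a set \<Rightarrow> 'a set list \<Rightarrow> bool" where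
  "type_classes v N Ps \<longleftrightarrow>
     distinct Ps \<and> set Ps = N // equi_desirability v N \<and>
     sorted_wrt (\<lambda>P Q. \<forall>i\<in>P. \<forall>j\<in>Q. (i, j) \<in> desirability v N \<and> (j, i) \<notin> desirability v N) Ps"

definition has_type_composition :: "('a set \<Rightarrow> nat) \<Rightarrow> 'a set \<Rightarrow> nat list \<Rightarrow> bool" where
  "has_type_composition v N ns \<longleftrightarrow> (\<exists>Ps. type_classes v N Ps \<and> ns = map card Ps)"

definition weighted_game :: "('a set \<Rightarrow> nat) \<Rightarrow> 'a set \<Rightarrow> bool" where
  "weighted_game v N \<longleftrightarrow>
     simple_game v N \<and>
     (\<exists>(w :: 'a \<Rightarrow> real) (q :: real). (\<forall>i\<in>N. w i \<ge> 0) \<and> q > 0 \<and>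
        (\<forall>S. S \<subseteq> N \<longrightarrow> (v S = 1 \<longleftrightarrow> (\<Sum>i\<in>S. w i) \<ge> q)))"

(* Agents are taken to be natural numbers, with N an arbitrary finite set of them. Every finite set
   of agents is in bijection with such an N, and the notions above are invariant under renaming of
   agents, so this is no restriction. *)

definition weighted_type_composition :: "nat list \<Rightarrow> bool" where
  "weighted_type_composition ns \<longleftrightarrow>
     (\<forall>(v :: nat set \<Rightarrow> nat) (N :: nat set).
        complete_simple_game v N \<and> has_type_composition v N ns \<longrightarrow> weighted_game v N)"

definition non_weighted_type_composition :: "nat list \<Rightarrow> bool" where
  "non_weighted_type_composition ns \<longleftrightarrow> \<not> weighted_type_composition ns"

end

theory Submission
  imports Defs "HOL-Library.Nat_Bijection"
begin

text \<open>
  Suppose first that all types are singletons, identified with \<open>0, \<dots>, t - 1\<close> in order of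
  increasing desirability. For \<open>t = 6\<close> there is a complete game with pairwise inequivalent agents in
  which two winning coalitions trade members and both become losing, so it is not weighted. Adding
  a most desirable agent that is a passer (winning on its own) or a vetoer keeps all this; the new
  agent is strictly more desirable than the others if the old game has no passer, respectively no
  vetoer. Since adding a passer destroys all vetoers and vice versa, the step can be iterated.
  For general class sizes, declare a coalition winning if its numbers of members of type at least
  \<open>k\<close> dominate, for all \<open>k\<close>, those of a winning coalition of the singleton game. On coalitions with
  at most one member of each type this is the singleton game again.
\<close>

section \<open>The shift order and families of winning coalitions with one agent per type\<close>

text \<open>Larger numbers are more desirable agents. For finite sets this is the usual domination
  order: \<open>B\<close> arises from \<open>A\<close> by replacing members by more desirable ones
  and adding members; \<open>k = 0\<close> compares the sizes.\<close>

definition shift_le :: "nat set \<Rightarrow> nat set \<Rightarrow> bool" where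
  "shift_le A B \<longleftrightarrow> (\<forall>k. card (A \<inter> {k..}) \<le> card (B \<inter> {k..}))"

text \<open>Closure covers both monotonicity, since \<open>shift_le\<close> extends inclusion on
  subsets of \<open>{..<t}\<close>, and the desirability order of the agents.\<close>

definition shift_closed :: "nat \<Rightarrow> nat set set \<Rightarrow> bool" where
  "shift_closed t G \<longleftrightarrow>
     G \<subseteq> Pow {..<t} \<and> (\<forall>A B. A \<in> G \<and> B \<subseteq> {..<t} \<and> shift_le A B \<longrightarrow> B \<in> G)"

text \<open>Shift closure makes larger agents at least as desirable; these witnesses make the
  comparison strict, so that no two agents are equivalent.\<close>

definition separated :: "nat \<Rightarrow> nat set set \<Rightarrow> bool" where
  "separated t G \<longleftrightarrow> (\<forall>l<t. \<forall>k<l. \<exists>A\<in>G. l \<in> A \<and> k \<notin> A \<and> insert k (A - {l}) \<notin> G)"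

text \<open>A certificate against weights: the winners \<open>A\<close>, \<open>B\<close> together
  contain every agent as often as the losers \<open>C\<close>, \<open>D\<close>, so both pairs have
  the same total weight.\<close>

definition has_trade :: "nat \<Rightarrow> nat set set \<Rightarrow> bool" where
  "has_trade t G \<longleftrightarrow>
     (\<exists>A\<in>G. \<exists>B\<in>G. \<exists>C D. C \<subseteq> {..<t} \<and> D \<subseteq> {..<t} \<and> C \<notin> G \<and> D \<notin> G \<and>
        A \<union> B = C \<union> D \<and> A \<inter> B = C \<inter> D)"

definition trading_family :: "nat \<Rightarrow> nat set set \<Rightarrow> bool" where
  "trading_family t G \<longleftrightarrow>
     shift_closed t G \<and> {} \<notin> G \<and> {..<t} \<in> G \<and> separated t G \<and> has_trade t G"

definition no_passer :: "nat \<Rightarrow> nat set set \<Rightarrow> bool" where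
  "no_passer t G \<longleftrightarrow> (\<forall>k<t. {k} \<notin> G)"

definition no_vetoer :: "nat \<Rightarrow> nat set set \<Rightarrow> bool" where
  "no_vetoer t G \<longleftrightarrow> (\<forall>k<t. {..<t} - {k} \<in> G)"

lemma shift_le_refl [simp]: "shift_le A A"
  by (simp add: shift_le_def)

lemma shift_le_trans: "shift_le A B \<Longrightarrow> shift_le B C \<Longrightarrow> shift_le A C"
  unfolding shift_le_def by (meson le_trans)

text \<open>From \<open>n\<close> on both counts vanish, so finitely many comparisons decide the
  order and explicit instances can be evaluated.\<close>

lemma shift_le_bounded:
  assumes "A \<subseteq> {..<n}" "B \<subseteq> {..<n}"
  shows "shift_le A B \<longleftrightarrow> (\<forall>k<n. card (A \<inter> {k..}) \<le> card (B \<inter> {k..}))"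
proof -
  have "card (A \<inter> {k..}) \<le> card (B \<inter> {k..})" if "\<not> k < n" for k
  proof -
    have "A \<inter> {k..} = {}" using assms that by auto
    then show ?thesis by simp
  qed
  then show ?thesis unfolding shift_le_def by blast
qed

subsection \<open>A non-weighted complete game with six types\<close>

text \<open>Found by computer search over small antichains of the shift order: the winning coalitions
  \<open>{1, 3, 4}\<close> and \<open>{0, 2, 5}\<close> can be turned into the losing ones \<open>{0, 1, 2, 4}\<close> and \<open>{3, 5}\<close>.\<close>
definition six_generators :: "nat set set" where
  "six_generators = {{1, 3, 4}, {0, 2, 5}, {4, 5}}"

definition six_family :: "nat set set" where
  "six_family = {B. B \<subseteq> {..<6} \<and> (\<exists>A\<in>six_generators. shift_le A B)}"

lemma shift_le_six:
  assumes "A \<subseteq> {..<6}" "B \<subseteq> {..<6}"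
  shows "shift_le A B \<longleftrightarrow>
     card (A \<inter> {0..}) \<le> card (B \<inter> {0..}) \<and>
     card (A \<inter> {1..}) \<le> card (B \<inter> {1..}) \<and>
     card (A \<inter> {2..}) \<le> card (B \<inter> {2..}) \<and>
     card (A \<inter> {3..}) \<le> card (B \<inter> {3..}) \<and>
     card (A \<inter> {4..}) \<le> card (B \<inter> {4..}) \<and>
     card (A \<inter> {5..}) \<le> card (B \<inter> {5..})"
proof -
  have "{..<6::nat} = {0, 1, 2, 3, 4, 5}" by auto
  then have "(\<forall>k<6. P k) \<longleftrightarrow> P 0 \<and> P 1 \<and> P 2 \<and> P 3 \<and> P 4 \<and> P (5::nat)" for P
    by (metis (mono_tags, lifting) lessThan_iff insert_iff empty_iff)
  then show ?thesis
    unfolding shift_le_bounded[OF assms] .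
qed

lemma shift_le_card:
  assumes "shift_le A B"
  shows "card A \<le> card B"
proof -
  have "card (A \<inter> {0..}) \<le> card (B \<inter> {0..})"
    using assms unfolding shift_le_def by blast
  then show ?thesis by simp
qed

lemma mem_six_family:
  "B \<in> six_family \<longleftrightarrow> B \<subseteq> {..<6} \<and>
     (shift_le {1, 3, 4} B \<or> shift_le {0, 2, 5} B \<or> shift_le {4, 5} B)"
  by (simp add: six_family_def six_generators_def)

lemmas six_family_simps = mem_six_family shift_le_six Int_insert_left card_insert_if

lemma six_family_mem: "{1, 3, 4} \<in> six_family" "{0, 2, 5} \<in> six_family"
  by (simp_all add: six_family_simps)

lemma six_family_not_mem: "{0, 1, 2, 4} \<notin> six_family" "{3, 5} \<notin> six_family"
  by (simp_all add: six_family_simps)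

text \<open>Each generator has at least two members and the shift order cannot decrease the size.
  This excludes the empty coalition and passers.\<close>

lemma card_six_family: "B \<in> six_family \<Longrightarrow> 2 \<le> card B"
  unfolding mem_six_family by (auto dest!: shift_le_card)

lemma separated_six_family: "separated 6 six_family"
proof -
  define sep where "sep l k \<longleftrightarrow>
      (\<exists>A\<in>six_family. l \<in> A \<and> k \<notin> A \<and> insert k (A - {l}) \<notin> six_family)" for l k
  have a: "sep 1 0" "sep 3 0" "sep 4 0" "sep 3 2" "sep 4 2"
    unfolding sep_def by (rule bexI[of _ "{1, 3, 4}"], simp_all add: six_family_simps insert_Diff_if)+
  have b: "sep 2 1" "sep 5 1" "sep 5 3" "sep 5 4"
    unfolding sep_def by (rule bexI[of _ "{0, 2, 5}"], simp_all add: six_family_simps insert_Diff_if)+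
  have c: "sep 5 0" "sep 4 1" "sep 5 2" "sep 4 3"
    unfolding sep_def by (rule bexI[of _ "{4, 5}"], simp_all add: six_family_simps insert_Diff_if)+
  \<comment> \<open>No generator contains 2 without 0, or 3 without 1. The last two pairs use
    coalitions above \<open>{0, 2, 5}\<close> instead; both swaps lead to the losing
    \<open>{0, 1, 5}\<close>.\<close>
  have d: "sep 2 0"
    unfolding sep_def by (rule bexI[of _ "{1, 2, 5}"], simp_all add: six_family_simps insert_Diff_if)+
  have e: "sep 3 1"
    unfolding sep_def by (rule bexI[of _ "{0, 3, 5}"], simp_all add: six_family_simps insert_Diff_if)+
  have "sep l k" if "l < 6" "k < l" for l k
  proof -
    have "l \<in> {1, 2, 3, 4, 5}" "k \<in> {0, 1, 2, 3, 4}"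
      using that by auto
    then show ?thesis
      using \<open>k < l\<close> by (elim insertE emptyE) (simp_all add: a b c d e del: One_nat_def)
  qed
  then show ?thesis
    unfolding separated_def sep_def by blast
qed

lemma trading_family_six: "trading_family 6 six_family"
  unfolding trading_family_def
proof (intro conjI)
  show "shift_closed 6 six_family"
    unfolding shift_closed_def six_family_def using shift_le_trans by blast
  show "{} \<notin> six_family" using card_six_family by fastforce
  have "{..<6} = {0, 1, 2, 3, 4, 5::nat}" by auto
  then show "{..<6} \<in> six_family"
    by (simp add: six_family_simps)
  show "separated 6 six_family" by (rule separated_six_family)
  show "has_trade 6 six_family"
    unfolding has_trade_def
    by (rule bexI[of _ "{1, 3, 4}"], rule bexI[of _ "{0, 2, 5}"],
        rule exI[of _ "{0, 1, 2, 4}"], rule exI[of _ "{3, 5}"])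
      (use six_family_mem six_family_not_mem in auto)
qed

subsection \<open>Adding a passer or a vetoer\<close>

text \<open>The new agent is numbered \<open>t\<close>, above all old ones. Adding a passer and
  adding a vetoer are dual to each other under exchanging winning coalitions with complements of
  losing ones.\<close>

definition add_passer :: "nat \<Rightarrow> nat set set \<Rightarrow> nat set set" where
  "add_passer t G = G \<union> insert t ` Pow {..<t}"

definition add_vetoer :: "nat \<Rightarrow> nat set set \<Rightarrow> nat set set" where
  "add_vetoer t G = insert t ` G"

lemma mem_add_passer:
  assumes "G \<subseteq> Pow {..<t}"
  shows "A \<in> add_passer t G \<longleftrightarrow> A \<subseteq> {..<Suc t} \<and> (t \<in> A \<or> A \<in> G)"
proof -
  have "A \<in> insert t ` Pow {..<t}" if "A \<subseteq> {..<Suc t}" "t \<in> A"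
    by (rule image_eqI[of _ _ "A - {t}"]) (use that in \<open>auto simp: less_Suc_eq\<close>)
  then show ?thesis
    using assms unfolding add_passer_def by (fastforce simp: less_Suc_eq)
qed

lemma mem_add_vetoer:
  assumes "G \<subseteq> Pow {..<t}"
  shows "A \<in> add_vetoer t G \<longleftrightarrow> t \<in> A \<and> A - {t} \<in> G"
proof
  assume "A \<in> add_vetoer t G"
  then obtain B where "B \<in> G" "A = insert t B" unfolding add_vetoer_def by auto
  moreover from this have "t \<notin> B" using assms by auto
  ultimately show "t \<in> A \<and> A - {t} \<in> G" by simp
next
  assume "t \<in> A \<and> A - {t} \<in> G"
  then show "A \<in> add_vetoer t G"
    unfolding add_vetoer_def by (metis image_eqI insert_Diff)
qed

text \<open>At \<open>k = t\<close> only the agent \<open>t\<close> itself can be counted.\<close>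

lemma shift_le_top:
  assumes "shift_le A B" "t \<in> A" "A \<subseteq> {..<Suc t}" "B \<subseteq> {..<Suc t}"
  shows "t \<in> B"
proof (rule ccontr)
  assume "t \<notin> B"
  then have "B \<inter> {t..} = {}" using assms(4) by (auto simp: less_Suc_eq)
  moreover have "finite A" using assms(3) finite_subset by blast
  ultimately have "card (A \<inter> {t..}) > card (B \<inter> {t..})"
    using assms(2) by (auto simp: card_gt_0_iff)
  then show False
    using assms(1) by (simp add: shift_le_def leD)
qed

text \<open>Removing \<open>t\<close> lowers both counts by one for \<open>k \<le> t\<close> and
  changes neither for larger \<open>k\<close>.\<close>

lemma shift_le_remove_top:
  assumes "shift_le A B" "t \<in> A" "t \<in> B" "A \<subseteq> {..<Suc t}" "B \<subseteq> {..<Suc t}"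
  shows "shift_le (A - {t}) (B - {t})"
  unfolding shift_le_def
proof
  fix k
  have *: "card ((X - {t}) \<inter> {k..}) = card (X \<inter> {k..}) - (if k \<le> t then 1 else 0)"
    if "t \<in> X" for X
  proof -
    have "(X - {t}) \<inter> {k..} = (X \<inter> {k..}) - {t}" by auto
    then show ?thesis using that by (simp add: card_Diff_singleton_if)
  qed
  show "card ((A - {t}) \<inter> {k..}) \<le> card ((B - {t}) \<inter> {k..})"
    using assms(1-3) by (simp add: * shift_le_def diff_le_mono)
qed

text \<open>Coalitions without \<open>t\<close> win exactly as before, so the old separating
  witnesses and the trade carry over unchanged. Only the comparison of \<open>t\<close> with the old
  agents needs \<open>no_passer\<close>.\<close>

lemma trading_family_add_passer:
  assumes G: "trading_family t G" and nop: "no_passer t G"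
  shows "trading_family (Suc t) (add_passer t G)" "no_vetoer (Suc t) (add_passer t G)"
proof -
  have sub: "G \<subseteq> Pow {..<t}"
    and closed: "\<And>A B. A \<in> G \<Longrightarrow> B \<subseteq> {..<t} \<Longrightarrow> shift_le A B \<Longrightarrow> B \<in> G"
    using G unfolding trading_family_def shift_closed_def by blast+
  note mem = mem_add_passer[OF sub]
  have tG: "t \<notin> A" if "A \<in> G" for A
    using that sub by auto
  have less_ne: "t \<notin> A" if "A \<subseteq> {..<t}" for A
    using that by auto
  have "shift_closed (Suc t) (add_passer t G)"
    unfolding shift_closed_def
  proof (intro conjI allI impI; (elim conjE)?)
    show "add_passer t G \<subseteq> Pow {..<Suc t}" using mem by blast
  next
    fix A B
    assume A: "A \<in> add_passer t G" and B: "B \<subseteq> {..<Suc t}" and le: "shift_le A B"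
    show "B \<in> add_passer t G"
    \<comment> \<open>If \<open>B\<close> contains the passer it wins outright; otherwise neither
      \<open>A\<close> nor \<open>B\<close> contains \<open>t\<close>, and closure of
      \<open>G\<close> applies.\<close>
    proof (cases "t \<in> B")
      case False
      then have "t \<notin> A" using shift_le_top[OF le] A B mem by blast
      moreover have "B \<subseteq> {..<t}" using False B by (auto simp: less_Suc_eq)
      ultimately show ?thesis using closed le A B mem by blast
    qed (use B mem in blast)
  qed
  moreover have "{} \<notin> add_passer t G" "{..<Suc t} \<in> add_passer t G"
    using G by (auto simp: trading_family_def mem)
  moreover have "separated (Suc t) (add_passer t G)"
    unfolding separated_def
  proof (intro allI impI)
    fix l k
    assume l: "l < Suc t" and k: "k < l"
    show "\<exists>A\<in>add_passer t G. l \<in> A \<and> k \<notin> A \<and> insert k (A - {l}) \<notin> add_passer t G"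
    proof (cases "l = t")
      case True
      \<comment> \<open>The witness is \<open>{t}\<close>: the swap turns it into
        \<open>{k}\<close>, which loses as \<open>k\<close> is no passer.\<close>
      have "{k} \<notin> G" using nop k True by (simp add: no_passer_def)
      then show ?thesis
        using k True by (intro bexI[of _ "{t}"]) (auto simp: mem)
    next
      case False
      then obtain A where "A \<in> G" "l \<in> A" "k \<notin> A" "insert k (A - {l}) \<notin> G"
        using G l k unfolding trading_family_def separated_def by (metis less_Suc_eq)
      then show ?thesis
        using l k False tG[of A] mem by (intro bexI[of _ A]) (auto simp: add_passer_def)
    qed
  qed
  moreover have "has_trade (Suc t) (add_passer t G)"
  proof -
    obtain A B C D where *: "A \<in> G" "B \<in> G" "C \<subseteq> {..<t}" "D \<subseteq> {..<t}" "C \<notin> G" "D \<notin> G"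
        "A \<union> B = C \<union> D" "A \<inter> B = C \<inter> D"
      using G unfolding trading_family_def has_trade_def by blast
    have "A \<in> add_passer t G" "B \<in> add_passer t G"
      using *(1,2) by (auto simp: add_passer_def)
    moreover have "C \<subseteq> {..<Suc t}" "D \<subseteq> {..<Suc t}"
      using *(3,4) by auto
    moreover have "C \<notin> add_passer t G" "D \<notin> add_passer t G"
      using *(3-6) less_ne by (auto simp: mem)
    ultimately show ?thesis
      unfolding has_trade_def using *(7,8) by blast
  qed
  ultimately show "trading_family (Suc t) (add_passer t G)"
    by (simp add: trading_family_def)
  \<comment> \<open>Without \<open>t\<close> the old grand coalition wins; without any other agent
    the passer remains.\<close>
  have "{..<Suc t} - {t} = {..<t}" by auto
  then show "no_vetoer (Suc t) (add_passer t G)"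
    using G by (auto simp: no_vetoer_def trading_family_def mem less_Suc_eq)
qed

lemma trading_family_add_vetoer:
  assumes G: "trading_family t G" and nov: "no_vetoer t G"
  shows "trading_family (Suc t) (add_vetoer t G)" "no_passer (Suc t) (add_vetoer t G)"
proof -
  have sub: "G \<subseteq> Pow {..<t}"
    and closed: "\<And>A B. A \<in> G \<Longrightarrow> B \<subseteq> {..<t} \<Longrightarrow> shift_le A B \<Longrightarrow> B \<in> G"
    using G unfolding trading_family_def shift_closed_def by blast+
  note mem = mem_add_vetoer[OF sub]
  have tG: "t \<notin> A" if "A \<in> G" for A
    using that sub by auto
  have less_ne: "t \<notin> A" if "A \<subseteq> {..<t}" for A
    using that by auto
  have sub': "add_vetoer t G \<subseteq> Pow {..<Suc t}"
    using sub by (fastforce simp: add_vetoer_def less_Suc_eq)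
  have "shift_closed (Suc t) (add_vetoer t G)"
    unfolding shift_closed_def
  proof (intro conjI allI impI; (elim conjE)?)
    fix A B
    assume A: "A \<in> add_vetoer t G" and B: "B \<subseteq> {..<Suc t}" and le: "shift_le A B"
    have A': "t \<in> A" "A \<subseteq> {..<Suc t}" using A mem sub' by blast+
    have "t \<in> B" by (rule shift_le_top[OF le A' B])
    moreover have "shift_le (A - {t}) (B - {t})"
      by (rule shift_le_remove_top[OF le A'(1) _ A'(2) B]) fact
    moreover have "B - {t} \<subseteq> {..<t}" using B by (auto simp: less_Suc_eq)
    ultimately show "B \<in> add_vetoer t G"
      using closed A mem by blast
  qed (rule sub')
  moreover have "{} \<notin> add_vetoer t G" "{..<Suc t} \<in> add_vetoer t G"
    using G by (auto simp: trading_family_def add_vetoer_def lessThan_Suc)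
  moreover have "separated (Suc t) (add_vetoer t G)"
    unfolding separated_def
  proof (intro allI impI)
    fix l k
    assume l: "l < Suc t" and k: "k < l"
    show "\<exists>A\<in>add_vetoer t G. l \<in> A \<and> k \<notin> A \<and> insert k (A - {l}) \<notin> add_vetoer t G"
    proof (cases "l = t")
      case True
      \<comment> \<open>The witness contains everybody but \<open>k\<close>: it wins as
        \<open>k\<close> is no vetoer of \<open>G\<close>, and swapping \<open>t\<close> for
        \<open>k\<close> removes the new vetoer.\<close>
      have "{..<t} - {k} \<in> G" using nov k True by (simp add: no_vetoer_def)
      then have "insert t ({..<t} - {k}) \<in> add_vetoer t G" by (simp add: add_vetoer_def)
      then show ?thesis
        using k True by (intro bexI[of _ "insert t ({..<t} - {k})"]) (auto simp: mem)
    next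
      case False
      then obtain A where A: "A \<in> G" "l \<in> A" "k \<notin> A" "insert k (A - {l}) \<notin> G"
        using G l k unfolding trading_family_def separated_def by (metis less_Suc_eq)
      have "t \<notin> A" by (rule tG) fact
      then have "insert k (insert t A - {l}) - {t} = insert k (A - {l})"
        using l k False by auto
      then have "insert k (insert t A - {l}) \<notin> add_vetoer t G"
        using A(4) mem by metis
      moreover have "insert t A \<in> add_vetoer t G"
        using A(1) by (simp add: add_vetoer_def)
      moreover have "k \<noteq> t" using l k by simp
      ultimately show ?thesis using A(2,3) by blast
    qed
  qed
  moreover have "has_trade (Suc t) (add_vetoer t G)"
  proof -
    obtain A B C D where *: "A \<in> G" "B \<in> G" "C \<subseteq> {..<t}" "D \<subseteq> {..<t}" "C \<notin> G" "D \<notin> G"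
        "A \<union> B = C \<union> D" "A \<inter> B = C \<inter> D"
      using G unfolding trading_family_def has_trade_def by blast
    \<comment> \<open>The vetoer joins all four coalitions, which preserves who wins and the
      equalities of unions and intersections.\<close>
    have "insert t A \<in> add_vetoer t G" "insert t B \<in> add_vetoer t G"
      using *(1,2) by (auto simp: add_vetoer_def)
    moreover have "insert t C \<subseteq> {..<Suc t}" "insert t D \<subseteq> {..<Suc t}"
      using *(3,4) by auto
    moreover have "insert t C \<notin> add_vetoer t G" "insert t D \<notin> add_vetoer t G"
      using *(3-6) less_ne by (auto simp: mem)
    moreover have "insert t A \<union> insert t B = insert t C \<union> insert t D"
      "insert t A \<inter> insert t B = insert t C \<inter> insert t D"
      using *(7,8) by blast+
    ultimately show ?thesis
      unfolding has_trade_def by blast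
  qed
  ultimately show "trading_family (Suc t) (add_vetoer t G)"
    by (simp add: trading_family_def)
  \<comment> \<open>Among singletons only \<open>{t}\<close> contains the vetoer, and it would win
    only if \<open>{}\<close> were in \<open>G\<close>.\<close>
  show "no_passer (Suc t) (add_vetoer t G)"
    using G by (auto simp: no_passer_def trading_family_def mem)
qed

lemma trading_family_exists:
  assumes "t \<ge> 6"
  shows "\<exists>G. trading_family t G"
proof -
  \<comment> \<open>The disjunction is the induction invariant: each kind of extension requires one
    alternative and yields the other.\<close>
  have "\<exists>G. trading_family t G \<and> (no_passer t G \<or> no_vetoer t G)"
    using assms
  proof (induction rule: dec_induct)
    case base
    have "no_passer 6 six_family"
      using card_six_family by (fastforce simp: no_passer_def)
    then show ?case
      using trading_family_six by blast
  next
    case (step t)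
    then show ?case
      using trading_family_add_passer trading_family_add_vetoer by blast
  qed
  then show ?thesis by blast
qed

subsection \<open>Blowing up a family to a game with given class sizes\<close>

text \<open>The shift order with a coalition of agents on the right, whose types are counted with
  multiplicity.\<close>

definition type_counts_le :: "('a \<Rightarrow> nat) \<Rightarrow> nat set \<Rightarrow> 'a set \<Rightarrow> bool" where
  "type_counts_le \<tau> A S \<longleftrightarrow> (\<forall>k. card (A \<inter> {k..}) \<le> card {i\<in>S. k \<le> \<tau> i})"

definition blowup :: "('a \<Rightarrow> nat) \<Rightarrow> nat set set \<Rightarrow> 'a set \<Rightarrow> nat" where
  "blowup \<tau> G S = (if \<exists>A\<in>G. type_counts_le \<tau> A S then 1 else 0)"

locale blowup_game =
  fixes t :: nat and G :: "nat set set" and N :: "'a set" and \<tau> :: "'a \<Rightarrow> nat"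
  assumes family: "trading_family t G"
    and finite_agents: "finite N"
    and types: "\<tau> ` N = {..<t}"
begin

abbreviation v :: "'a set \<Rightarrow> nat" where
  "v \<equiv> blowup \<tau> G"

lemma v_mono:
  assumes "S \<subseteq> T" "T \<subseteq> N"
  shows "v S \<le> v T"
proof -
  have "card {i\<in>S. k \<le> \<tau> i} \<le> card {i\<in>T. k \<le> \<tau> i}" for k
    by (rule card_mono) (use assms finite_subset[OF assms(2) finite_agents] in auto)
  then show ?thesis
    unfolding blowup_def type_counts_le_def by (auto intro: le_trans)
qed

lemma v_transversal:
  assumes s: "\<And>k. k < t \<Longrightarrow> \<tau> (s k) = k" and A: "A \<subseteq> {..<t}"
  shows "v (s ` A) = 1 \<longleftrightarrow> A \<in> G"
proof -
  have "card {i \<in> s ` A. k \<le> \<tau> i} = card (A \<inter> {k..})" for k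
  proof -
    have "{i \<in> s ` A. k \<le> \<tau> i} = s ` (A \<inter> {k..})"
      using s A by force
    moreover have "inj_on s (A \<inter> {k..})"
      using s A by (intro inj_on_inverseI[of _ \<tau>]) auto
    ultimately show ?thesis by (simp add: card_image)
  qed
  then have "type_counts_le \<tau> B (s ` A) \<longleftrightarrow> shift_le B A" for B
    by (simp add: type_counts_le_def shift_le_def)
  then show ?thesis
    using family A shift_le_refl[of A]
    unfolding blowup_def trading_family_def shift_closed_def by (auto simp: Bex_def)
qed

lemma transversal_exists:
  obtains s where "\<And>k. k < t \<Longrightarrow> s k \<in> N" "\<And>k. k < t \<Longrightarrow> \<tau> (s k) = k"
proof -
  have "\<forall>k\<in>{..<t}. \<exists>i. i \<in> N \<and> \<tau> i = k"
    using types by (metis imageE)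
  then show ?thesis using that bchoice[of "{..<t}" "\<lambda>k i. i \<in> N \<and> \<tau> i = k"] by auto
qed

lemma simple_game_v: "simple_game v N"
proof -
  obtain s where s: "\<And>k. k < t \<Longrightarrow> s k \<in> N" "\<And>k. k < t \<Longrightarrow> \<tau> (s k) = k"
    by (rule transversal_exists) blast
  have "v {} \<noteq> 1"
    using v_transversal[OF s(2), of "{}"] family by (simp add: trading_family_def)
  then have "v {} = 0" by (simp add: blowup_def split: if_splits)
  moreover have "v (s ` {..<t}) = 1"
    using v_transversal[OF s(2), of "{..<t}"] family by (simp add: trading_family_def)
  moreover have "v (s ` {..<t}) \<le> v N"
    by (rule v_mono) (use s in auto)
  moreover have "v S \<in> {0, 1}" for S
    by (simp add: blowup_def)
  ultimately show ?thesis
    unfolding simple_game_def using finite_agents v_mono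
    by (metis insertE singletonD le_zero_eq one_neq_zero)
qed

lemma type_ge_imp_desirable:
  assumes "i \<in> N" "j \<in> N" "\<tau> j \<le> \<tau> i"
  shows "(i, j) \<in> desirability v N"
proof -
  have "v S \<le> v (({i} \<union> S) - {j})" if S: "{j} \<subseteq> S" "S \<subseteq> N - {i}" for S
  proof -
    have "card {x\<in>S. k \<le> \<tau> x} \<le> card {x \<in> ({i} \<union> S) - {j}. k \<le> \<tau> x}" for k
    proof -
      let ?X = "{x\<in>S. k \<le> \<tau> x}"
      have fin: "finite S" using S finite_agents finite_subset by blast
      show ?thesis
      proof (cases "k \<le> \<tau> j")
        \<comment> \<open>Here \<open>k \<le> \<tau> j \<le> \<tau> i\<close>, so the swap loses one
          counted agent and gains one; in the other case \<open>j\<close> is not counted and nothing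
          is lost.\<close>
        case True
        then have "{x \<in> ({i} \<union> S) - {j}. k \<le> \<tau> x} = insert i (?X - {j})"
          using S assms by auto
        moreover have "i \<notin> ?X - {j}" "j \<in> ?X" using S True by auto
        ultimately show ?thesis
          using fin by (simp add: card_Suc_Diff1 del: card_Diff_insert)
      next
        case False
        then show ?thesis using fin by (intro card_mono) auto
      qed
    qed
    then show ?thesis
      unfolding blowup_def type_counts_le_def by (auto intro: le_trans)
  qed
  then show ?thesis using assms by (simp add: desirability_def)
qed

lemma type_less_imp_not_desirable:
  assumes i: "i \<in> N" and j: "j \<in> N" and less: "\<tau> j < \<tau> i"
  shows "(j, i) \<notin> desirability v N"
proof -
  obtain s0 where s0: "\<And>k. k < t \<Longrightarrow> s0 k \<in> N" "\<And>k. k < t \<Longrightarrow> \<tau> (s0 k) = k"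
    by (rule transversal_exists) blast
  \<comment> \<open>A transversal forced through \<open>i\<close> and \<open>j\<close> transports
    the separating coalition for their types to one for these two agents.\<close>
  define s where "s = s0(\<tau> i := i, \<tau> j := j)"
  have s: "\<And>k. k < t \<Longrightarrow> s k \<in> N" "\<And>k. k < t \<Longrightarrow> \<tau> (s k) = k"
    using s0 i j by (auto simp: s_def)
  have si: "s (\<tau> i) = i" and sj: "s (\<tau> j) = j"
    using less by (auto simp: s_def)
  have lt: "\<tau> i < t" using i types by blast
  obtain A where A: "A \<in> G" "\<tau> i \<in> A" "\<tau> j \<notin> A" "insert (\<tau> j) (A - {\<tau> i}) \<notin> G"
    using family lt less unfolding trading_family_def separated_def by blast
  have At: "A \<subseteq> {..<t}"
    using family A(1) unfolding trading_family_def shift_closed_def by blast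
  have inj: "inj_on s {..<t}"
    by (rule inj_on_inverseI[of _ \<tau>]) (use s in auto)
  have "j \<notin> s ` A"
    using At A(3) s(2) by force
  moreover have "i \<in> s ` A" using A(2) si by force
  moreover have "s ` (A - {\<tau> i}) = s ` A - {i}"
    using inj_on_image_set_diff[OF inj, of A "{\<tau> i}"] At lt si by auto
  then have "s ` insert (\<tau> j) (A - {\<tau> i}) = ({j} \<union> s ` A) - {i}"
    using sj less by auto
  moreover have "v (s ` A) = 1"
    using v_transversal[OF s(2) At] A(1) by simp
  moreover have "v (s ` insert (\<tau> j) (A - {\<tau> i})) \<noteq> 1"
    using v_transversal[OF s(2), of "insert (\<tau> j) (A - {\<tau> i})"] A(4) At lt less by auto
  then have "v (s ` insert (\<tau> j) (A - {\<tau> i})) = 0"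
    by (simp add: blowup_def split: if_splits)
  moreover have "s ` A \<subseteq> N" using s(1) At by blast
  ultimately have "{i} \<subseteq> s ` A" "s ` A \<subseteq> N - {j}" "\<not> v (s ` A) \<le> v (({j} \<union> s ` A) - {i})"
    by auto
  then show ?thesis unfolding desirability_def by blast
qed

lemma desirability_v: "desirability v N = {(i, j). i \<in> N \<and> j \<in> N \<and> \<tau> j \<le> \<tau> i}"
proof -
  have "(i, j) \<in> desirability v N \<longleftrightarrow> i \<in> N \<and> j \<in> N \<and> \<tau> j \<le> \<tau> i" for i j
  proof -
    have "(i, j) \<in> desirability v N \<Longrightarrow> i \<in> N \<and> j \<in> N"
      by (simp add: desirability_def)
    then show ?thesis
      using type_ge_imp_desirable type_less_imp_not_desirable not_less by blast
  qed
  then show ?thesis by blast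
qed

lemma complete_simple_game_v: "complete_simple_game v N"
proof -
  have "preorder_on N (desirability v N)"
    unfolding preorder_on_def desirability_v by (auto intro: refl_onI transI)
  moreover have "total_on N (desirability v N)"
    by (auto simp: total_on_def desirability_v)
  ultimately show ?thesis
    using simple_game_v by (simp add: complete_simple_game_def)
qed

text \<open>The classes are the fibres of \<open>\<tau>\<close>. The list is reversed because types
  grow with desirability, while a composition starts with the most desirable class.\<close>

lemma has_type_composition_v:
  "has_type_composition v N (map (\<lambda>k. card {i\<in>N. \<tau> i = k}) (rev [0..<t]))"
proof -
  let ?P = "\<lambda>k. {i\<in>N. \<tau> i = k}"
  have equi: "equi_desirability v N = {(i, j). i \<in> N \<and> j \<in> N \<and> \<tau> i = \<tau> j}"
    by (auto simp: equi_desirability_def desirability_v)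
  \<comment> \<open>Fibres of different types differ because each is nonempty.\<close>
  have "inj_on ?P {..<t}"
  proof (rule inj_onI)
    fix k l assume "k \<in> {..<t}" and eq: "?P k = ?P l"
    then obtain i where "i \<in> N" "\<tau> i = k" using types by (metis imageE)
    then have "i \<in> ?P l" using eq by blast
    then show "k = l" using \<open>\<tau> i = k\<close> by simp
  qed
  then have "distinct (map ?P (rev [0..<t]))"
    by (simp add: distinct_map atLeast0LessThan)
  moreover have "set (map ?P (rev [0..<t])) = N // equi_desirability v N"
  proof -
    have "equi_desirability v N `` {i} = ?P (\<tau> i)" if "i \<in> N" for i
      using that by (auto simp: equi)
    then have "N // equi_desirability v N = ?P ` \<tau> ` N"
      unfolding quotient_def by auto
    then show ?thesis by (simp add: types atLeast0LessThan)
  qed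
  moreover have "sorted_wrt (\<lambda>P Q. \<forall>i\<in>P. \<forall>j\<in>Q. (i, j) \<in> desirability v N \<and>
      (j, i) \<notin> desirability v N) (map ?P (rev [0..<t]))"
  proof -
    have "sorted_wrt (\<lambda>x y. y < x) (rev [0..<t])"
      by (simp add: sorted_wrt_rev)
    then show ?thesis
      unfolding sorted_wrt_map by (rule sorted_wrt_mono_rel[rotated]) (auto simp: desirability_v)
  qed
  ultimately have "type_classes v N (map ?P (rev [0..<t]))"
    by (simp add: type_classes_def)
  then show ?thesis
    unfolding has_type_composition_def by (intro exI[of _ "map ?P (rev [0..<t])"]) (simp add: comp_def)
qed

lemma not_weighted_game_v: "\<not> weighted_game v N"
proof
  assume "weighted_game v N"
  then obtain w :: "'a \<Rightarrow> real" and q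
    where wq: "\<And>S. S \<subseteq> N \<Longrightarrow> v S = 1 \<longleftrightarrow> (\<Sum>i\<in>S. w i) \<ge> q"
    unfolding weighted_game_def by blast
  obtain s where s: "\<And>k. k < t \<Longrightarrow> s k \<in> N" "\<And>k. k < t \<Longrightarrow> \<tau> (s k) = k"
    by (rule transversal_exists) blast
  \<comment> \<open>The weights are pulled back along a transversal, so that the same quota would
    represent the singleton game.\<close>
  have win: "A \<in> G \<longleftrightarrow> (\<Sum>k\<in>A. w (s k)) \<ge> q" if A: "A \<subseteq> {..<t}" for A
  proof -
    have "inj_on s A"
      by (rule inj_on_inverseI[of _ \<tau>]) (use s A in auto)
    moreover have "s ` A \<subseteq> N" using s(1) A by blast
    ultimately show ?thesis
      using v_transversal[OF s(2) A] wq[of "s ` A"] by (simp add: sum.reindex)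
  qed
  have sub: "G \<subseteq> Pow {..<t}"
    using family unfolding trading_family_def shift_closed_def by blast
  obtain A B C D where AB: "A \<in> G" "B \<in> G" and CD: "C \<subseteq> {..<t}" "D \<subseteq> {..<t}" "C \<notin> G" "D \<notin> G"
    and eq: "A \<union> B = C \<union> D" "A \<inter> B = C \<inter> D"
    using family unfolding trading_family_def has_trade_def by blast
  have AB': "A \<subseteq> {..<t}" "B \<subseteq> {..<t}" using AB sub by auto
  have fin: "finite A" "finite B" "finite C" "finite D"
    using AB' CD finite_subset by blast+
  \<comment> \<open>The left side is at least \<open>2 * q\<close> as \<open>A\<close> and
    \<open>B\<close> win, the right side is less as \<open>C\<close> and \<open>D\<close>
    lose.\<close>
  have "(\<Sum>k\<in>A. w (s k)) + (\<Sum>k\<in>B. w (s k)) = (\<Sum>k\<in>C. w (s k)) + (\<Sum>k\<in>D. w (s k))"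
    using sum.union_inter[OF fin(1,2), of "\<lambda>k. w (s k)"]
      sum.union_inter[OF fin(3,4), of "\<lambda>k. w (s k)"] eq by simp
  then show False
    using win[OF AB'(1)] win[OF AB'(2)] win[OF CD(1)] win[OF CD(2)] AB CD by linarith
qed

end

section \<open>Realising prescribed class sizes by natural numbers\<close>

lemma agents_with_type_sizes:
  fixes m :: "nat \<Rightarrow> nat"
  obtains N :: "nat set" and \<tau> where "finite N" "\<tau> ` N \<subseteq> {..<t}"
    "\<And>k. k < t \<Longrightarrow> card {i\<in>N. \<tau> i = k} = m k"
proof -
  \<comment> \<open>Agent number \<open>j\<close> of type \<open>k\<close> is the pair
    \<open>(k, j)\<close>, encoded as a natural number.\<close>
  define N where "N = prod_encode ` (SIGMA k:{..<t}. {..<m k})"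
  define \<tau> where "\<tau> i = fst (prod_decode i)" for i
  have "card {i\<in>N. \<tau> i = k} = m k" if "k < t" for k
  proof -
    have "{i\<in>N. \<tau> i = k} = prod_encode ` ({k} \<times> {..<m k})"
      using that by (auto simp: N_def \<tau>_def)
    then show ?thesis
      by (simp add: card_image inj_prod_encode card_cartesian_product)
  qed
  moreover have "finite N" "\<tau> ` N \<subseteq> {..<t}"
    by (auto simp: N_def \<tau>_def)
  ultimately show ?thesis using that by blast
qed

theorem lemma4:
  fixes ns :: "nat list" and t :: nat
  assumes "length ns = t"
    and "\<forall>n \<in> set ns. n > 0"
    and "t \<ge> 6"
  shows "non_weighted_type_composition ns"
proof -
  obtain G where G: "trading_family t G"
    using trading_family_exists[OF assms(3)] by blast
  obtain N :: "nat set" and \<tau> where N: "finite N" "\<tau> ` N \<subseteq> {..<t}"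
    and sizes: "\<And>k. k < t \<Longrightarrow> card {i\<in>N. \<tau> i = k} = rev ns ! k"
    using agents_with_type_sizes[where m = "\<lambda>k. rev ns ! k"] by metis
  \<comment> \<open>Positivity of the entries of \<open>ns\<close> makes every type occur, as the
    blowup requires.\<close>
  have "k \<in> \<tau> ` N" if "k < t" for k
  proof -
    have "rev ns ! k \<in> set ns"
      using that assms(1) by (metis length_rev nth_mem set_rev)
    then have "card {i\<in>N. \<tau> i = k} > 0"
      using sizes[OF that] assms(2) by simp
    then show ?thesis by (auto simp: card_gt_0_iff)
  qed
  then interpret blowup_game t G N \<tau>
    using G N by unfold_locales auto
  have "map (\<lambda>k. card {i\<in>N. \<tau> i = k}) [0..<t] = rev ns"
    using sizes assms(1) by (intro nth_equalityI) auto
  then have "map (\<lambda>k. card {i\<in>N. \<tau> i = k}) (rev [0..<t]) = ns"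
    by (metis rev_map rev_rev_ident)
  then show ?thesis
    using complete_simple_game_v has_type_composition_v not_weighted_game_v
    unfolding non_weighted_type_composition_def weighted_type_composition_def by metis
qed

end
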